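(* Let $D_{2n}=\langle a,b\mid a^n=b^2=e,\ bab=a^{-1}\rangle$ be the dihedral group of order $2n\ge 6$, and let $H$ be a proper subgroup of $D_{2n}$. Then the following statements hold for any integer $k$ between $1$ and $|H|$ (inclusive): (a) if $k$ is even, then $H$ is a $(0,k)$-regular set of $D_{2n}$; (b) if $k$ is odd, then $H$ is a $(0,k)$-regular set of $D_{2n}$ if and only if $H\nleq\langle a\rangle$, or $H\le\langle a\rangle$ with at least one of $|H|$ and $\frac{n}{|H|}$ odd.
   Context: For a finite group $G$ with identity $e$ and an inverse-closed subset $S$ of $G\setminus\{e\}$ (i.e. $S^{-1}=S$), $\mathrm{Cay}(G,S)$ is the graph with vertex set $G$ and edge set $\{\{x,y\}: x,y\in G,\ yx^{-1}\in S\}$. A $(0,k)$-regular set in a graph $\Gamma$ is a nonempty proper subset $D$ of $V(\Gamma)$ such that every vertex in $D$ has no neighbour in $D$ and every vertex in $V(\Gamma)\setminus D$ has exactly $k$ neighbours in $D$. A subset $D$ of a group $G$ is a $(0,k)$-regular set of $G$ if it is a $(0,k)$-regular set in $\mathrm{Cay}(G,S)$ for some inverse-closed $S\subseteq G\setminus\{e\}$. *)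

theory Defs
  imports "HOL-Algebra.Generated_Groups"
begin

text \<open>
  A group generated by \<open>a\<close> and \<open>b\<close> subject to the three relations consists of the elements
  \<open>a\<^sup>i b\<^sup>j\<close> with \<open>i < n\<close> and \<open>j < 2\<close>, so it is a quotient of the group presented by them;
  requiring its order to be \<open>2 n\<close> makes it that group.
\<close>

definition dihedral_group :: "('a, 'm) monoid_scheme \<Rightarrow> nat \<Rightarrow> 'a \<Rightarrow> 'a \<Rightarrow> bool" where
  "dihedral_group G n a b \<longleftrightarrow>
     group G \<and> a \<in> carrier G \<and> b \<in> carrier G \<and>
     generate G {a, b} = carrier G \<and>
     a [^]\<^bsub>G\<^esub> n = \<one>\<^bsub>G\<^esub> \<and> b [^]\<^bsub>G\<^esub> (2::nat) = \<one>\<^bsub>G\<^esub> \<and>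
     b \<otimes>\<^bsub>G\<^esub> a \<otimes>\<^bsub>G\<^esub> b = inv\<^bsub>G\<^esub> a \<and>
     order G = 2 * n"

text \<open>A graph is given by its vertex set and its set of unordered edges.\<close>

definition cayley_graph :: "('a, 'm) monoid_scheme \<Rightarrow> 'a set \<Rightarrow> 'a set \<times> 'a set set" where
  "cayley_graph G S =
     (carrier G,
      {{x, y} | x y. x \<in> carrier G \<and> y \<in> carrier G \<and> y \<otimes>\<^bsub>G\<^esub> inv\<^bsub>G\<^esub> x \<in> S})"

definition neighbours :: "'v set \<times> 'v set set \<Rightarrow> 'v \<Rightarrow> 'v set" where
  "neighbours \<Gamma> v = {u \<in> fst \<Gamma>. {v, u} \<in> snd \<Gamma>}"

definition zero_regular_set :: "'v set \<times> 'v set set \<Rightarrow> nat \<Rightarrow> 'v set \<Rightarrow> bool" where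
  "zero_regular_set \<Gamma> k D \<longleftrightarrow>
     D \<noteq> {} \<and> D \<subset> fst \<Gamma> \<and>
     (\<forall>v \<in> D. neighbours \<Gamma> v \<inter> D = {}) \<and>
     (\<forall>v \<in> fst \<Gamma> - D. card (neighbours \<Gamma> v \<inter> D) = k)"

definition inverse_closed :: "('a, 'm) monoid_scheme \<Rightarrow> 'a set \<Rightarrow> bool" where
  "inverse_closed G S \<longleftrightarrow> m_inv G ` S = S"

definition group_zero_regular_set :: "('a, 'm) monoid_scheme \<Rightarrow> nat \<Rightarrow> 'a set \<Rightarrow> bool" where
  "group_zero_regular_set G k D \<longleftrightarrow>
     (\<exists>S. S \<subseteq> carrier G - {\<one>\<^bsub>G\<^esub>} \<and> inverse_closed G S \<and>
          zero_regular_set (cayley_graph G S) k D)"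


text \<open>
  Dihedral groups of every order exist: \<open>(i, s)\<close> stands for \<open>a\<^sup>i b\<close> if \<open>s\<close> holds and for
  \<open>a\<^sup>i\<close> otherwise.
\<close>

definition dihedral_model :: "nat \<Rightarrow> (int \<times> bool) monoid" where
  "dihedral_model n =
     \<lparr>carrier = {0..<int n} \<times> UNIV,
      mult = (\<lambda>(i, s) (j, t). ((if s then i - j else i + j) mod int n, s \<noteq> t)),
      one = (0, False)\<rparr>"

lemma group_dihedral_model:
  assumes "n > 0"
  shows "group (dihedral_model n)"
proof (rule groupI)
  fix x assume x: "x \<in> carrier (dihedral_model n)"
  obtain i s where xs: "x = (i, s)" by (cases x)
  have "(if s then x else ((- i) mod int n, False)) \<in> carrier (dihedral_model n)"
    using x assms by (auto simp: dihedral_model_def)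
  moreover have "(if s then x else ((- i) mod int n, False)) \<otimes>\<^bsub>dihedral_model n\<^esub> x
      = \<one>\<^bsub>dihedral_model n\<^esub>"
    by (auto simp: xs dihedral_model_def mod_simps)
  ultimately show "\<exists>y \<in> carrier (dihedral_model n).
      y \<otimes>\<^bsub>dihedral_model n\<^esub> x = \<one>\<^bsub>dihedral_model n\<^esub>"
    by blast
qed (use assms in \<open>auto simp: dihedral_model_def mod_simps algebra_simps\<close>)

lemma dihedral_group_dihedral_model:
  assumes "n \<ge> 3"
  shows "dihedral_group (dihedral_model n) n (1, False) (0, True)"
proof -
  let ?G = "dihedral_model n"
  interpret G: group ?G using assms by (intro group_dihedral_model) simp
  have pow: "(1, False) [^]\<^bsub>?G\<^esub> m = (int m mod int n, False)" for m :: nat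
    by (induction m) (auto simp: G.nat_pow_Suc dihedral_model_def mod_simps add.commute)
  have car: "(1, False) \<in> carrier ?G" "(0, True) \<in> carrier ?G"
    using assms by (auto simp: dihedral_model_def)
  have "carrier ?G \<subseteq> generate ?G {(1, False), (0, True)}"
  proof
    fix x assume x: "x \<in> carrier ?G"
    obtain i s where xs: "x = (i, s)" by (cases x)
    have "subgroup (generate ?G {(1, False), (0, True)}) ?G"
      using car by (intro G.generate_is_subgroup) auto
    moreover have "(1, False) \<in> generate ?G {(1, False), (0, True)}"
      by (auto intro: generate.incl)
    ultimately have "(1, False) [^]\<^bsub>?G\<^esub> m \<in> generate ?G {(1, False), (0, True)}" for m :: nat
      by (induction m) (auto simp: subgroup.one_closed subgroup.m_closed)
    from this[of "nat i"] have i: "(i, False) \<in> generate ?G {(1, False), (0, True)}"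
      using x unfolding pow by (simp add: xs dihedral_model_def)
    moreover have "(i, True) = (i, False) \<otimes>\<^bsub>?G\<^esub> (0, True)"
      using x by (simp add: xs dihedral_model_def)
    ultimately show "x \<in> generate ?G {(1, False), (0, True)}"
      unfolding xs by (cases s) (auto intro: generate.eng generate.incl)
  qed
  moreover have "generate ?G {(1, False), (0, True)} \<subseteq> carrier ?G"
    using car by (intro G.generate_incl) auto
  moreover have "(0, True) \<otimes>\<^bsub>?G\<^esub> (1, False) \<otimes>\<^bsub>?G\<^esub> (0, True) = inv\<^bsub>?G\<^esub> (1, False)"
    using assms car
    by (intro G.inv_equality[symmetric]) (auto simp: dihedral_model_def mod_simps)
  moreover have "order ?G = 2 * n"
    by (simp add: order_def dihedral_model_def card_cartesian_product)
  moreover have "(0, True) [^]\<^bsub>?G\<^esub> (2::nat) = \<one>\<^bsub>?G\<^esub>"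
    by (simp add: numeral_2_eq_2 dihedral_model_def)
  moreover have "(1, False) [^]\<^bsub>?G\<^esub> n = \<one>\<^bsub>?G\<^esub>"
    by (subst pow) (simp add: dihedral_model_def)
  ultimately show ?thesis
    unfolding dihedral_group_def using car G.is_group by blast
qed

end

(* A subgroup H is (0,k)-regular iff some inverse-closed S misses H and has exactly k elements in
   every nontrivial right coset of H.  Reflections are involutions, so any of them may be put into S.
   If H contains a reflection, every coset has as many rotations as reflections; S then consists of
   reflections only or, for large k, of all rotations outside H and some reflections.
   If H consists of rotations, it is normal and inversion permutes its cosets, so only the self-inverse
   cosets restrict S.  Such a coset contains an inversion-invariant set of size k if k is even or the
   coset contains an involution.  The only possible obstruction is thus a coset Hg of a rotation g not in
   H with g^2 in H; it exists iff n/|H| is even, and it contains an involution iff |H| is odd, because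
   the unique involution of a cyclic group lies in every subgroup of even order. *)
theory Submission
  imports Defs "HOL-Algebra.Multiplicative_Group"
begin

section \<open>Sets invariant under an involution\<close>

text \<open>The pairs \<open>{x, f x}\<close> partition \<open>A\<close>; the induction removes one
  such pair at a time.\<close>

lemma even_card_fixpoint_free_involution:
  assumes "finite A" "\<And>x. x \<in> A \<Longrightarrow> f x \<in> A \<and> f (f x) = x \<and> f x \<noteq> x"
  shows "even (card A)"
  using assms
proof (induction "card A" arbitrary: A rule: less_induct)
  case less
  show ?case
  proof (cases "A = {}")
    case False
    then obtain x where x: "x \<in> A" by blast
    let ?B = "A - {x, f x}"
    have fx: "{x, f x} \<subseteq> A" "card {x, f x} = 2"
      using less.prems(2)[OF x] x by auto
    have card: "card ?B = card A - 2"
      using card_Diff_subset[of "{x, f x}" A] fx by simp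
    have two: "2 \<le> card A"
      using card_mono[OF less.prems(1) fx(1)] fx(2) by simp
    have "f y \<in> ?B \<and> f (f y) = y \<and> f y \<noteq> y" if "y \<in> ?B" for y
      using that less.prems(2)[of y] less.prems(2)[OF x] by auto
    then have "even (card ?B)"
      using card two less.prems(1) by (intro less.hyps) auto
    then show ?thesis using card two by simp
  qed simp
qed

text \<open>The subset grows by two elements at a time: by a pair that \<open>f\<close> exchanges
  while there is one outside \<open>B\<close>, and by any two fixed points otherwise.\<close>

lemma invariant_subset_even_card:
  assumes "finite A" "\<And>x. x \<in> A \<Longrightarrow> f x \<in> A \<and> f (f x) = x" "2 * j \<le> card A"
  shows "\<exists>B \<subseteq> A. f ` B \<subseteq> B \<and> card B = 2 * j"
  using assms(3)
proof (induction j)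
  case 0
  show ?case by (intro exI[of _ "{}"]) simp
next
  case (Suc j)
  then obtain B where B: "B \<subseteq> A" "f ` B \<subseteq> B" "card B = 2 * j"
    by auto
  have fin: "finite B" using B(1) assms(1) finite_subset by blast
  have "\<exists>D \<subseteq> A - B. f ` D \<subseteq> D \<and> card D = 2"
  proof (cases "\<exists>x \<in> A - B. f x \<noteq> x")
    case True
    then obtain x where x: "x \<in> A - B" "f x \<noteq> x" by blast
    have "f x \<notin> B"
      using x B(2) assms(2)[of x] by (metis DiffD1 DiffD2 image_subset_iff)
    then show ?thesis
      using x assms(2)[of x] by (intro exI[of _ "{x, f x}"]) auto
  next
    case False
    have "2 \<le> card (A - B)"
      using Suc.prems B card_Diff_subset[OF fin B(1)] by simp
    then obtain D where "D \<subseteq> A - B" "card D = 2"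
      by (meson obtain_subset_with_card_n)
    then show ?thesis using False by (intro exI[of _ D]) auto
  qed
  then obtain D where D: "D \<subseteq> A - B" "f ` D \<subseteq> D" "card D = 2" by blast
  \<comment> \<open>Infinite sets have cardinality 0, so \<open>card D = 2\<close> makes
    \<open>D\<close> finite.\<close>
  then have "card (B \<union> D) = 2 * Suc j"
    using B(3) fin card_gt_0_iff[of D] by (subst card_Un_disjoint) auto
  then show ?case
    using B D by (intro exI[of _ "B \<union> D"]) auto
qed

text \<open>For odd \<open>k\<close> one fixed point is set aside; the rest of \<open>A\<close> is
  still invariant and provides the remaining even number of elements.\<close>

lemma invariant_subset_card:
  assumes "finite A" "\<And>x. x \<in> A \<Longrightarrow> f x \<in> A \<and> f (f x) = x" "k \<le> card A"
    and "odd k \<Longrightarrow> \<exists>x \<in> A. f x = x"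
  shows "\<exists>B \<subseteq> A. f ` B \<subseteq> B \<and> card B = k"
proof (cases "even k")
  case True
  then show ?thesis
    using invariant_subset_even_card[OF assms(1,2), of "k div 2"] assms(3) by auto
next
  case False
  then obtain x where x: "x \<in> A" "f x = x" using assms(4) by blast
  have "f y \<in> A - {x} \<and> f (f y) = y" if "y \<in> A - {x}" for y
    using that assms(2)[of y] x by (metis DiffD1 DiffD2 DiffI singletonD singletonI)
  moreover have "2 * (k div 2) \<le> card (A - {x})"
    using False assms(1,3) x by simp
  ultimately obtain B where B: "B \<subseteq> A - {x}" "f ` B \<subseteq> B" "card B = 2 * (k div 2)"
    using invariant_subset_even_card[of "A - {x}" f "k div 2"] assms(1) by auto
  moreover have "finite B" using B(1) assms(1) by (meson finite_Diff finite_subset)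
  moreover have "x \<notin> B" using B(1) by blast
  ultimately have "card (insert x B) = k" using False by simp
  then show ?thesis
    using B x by (intro exI[of _ "insert x B"]) auto
qed

text \<open>A part that \<open>f\<close> exchanges with a different part imposes no constraint: any
  \<open>k\<close> of its elements may be chosen and mirrored by \<open>f\<close>. Only the parts
  mapped to themselves need an invariant choice, which \<open>self\<close> supplies.\<close>

lemma invariant_selection:
  assumes disj: "pairwise disjnt P"
    and inv: "\<And>C x. C \<in> P \<Longrightarrow> x \<in> C \<Longrightarrow> f (f x) = x"
    and img: "\<And>C. C \<in> P \<Longrightarrow> f ` C \<in> P"
    and le: "\<And>C. C \<in> P \<Longrightarrow> k \<le> card C"
    and self: "\<And>C. C \<in> P \<Longrightarrow> f ` C = C \<Longrightarrow> \<exists>B \<subseteq> C. f ` B \<subseteq> B \<and> card B = k"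
  shows "\<exists>S \<subseteq> \<Union>P. f ` S \<subseteq> S \<and> (\<forall>C \<in> P. card (S \<inter> C) = k)"
proof -
  have ff: "f ` f ` X = X" if "C \<in> P" "X \<subseteq> C" for C X
    using inv[OF that(1)] that(2) by (force simp: image_image)
  have "\<forall>C \<in> P. \<exists>B \<subseteq> C. card B = k \<and> (f ` C = C \<longrightarrow> f ` B \<subseteq> B)"
  proof
    fix C assume "C \<in> P"
    then show "\<exists>B \<subseteq> C. card B = k \<and> (f ` C = C \<longrightarrow> f ` B \<subseteq> B)"
      using self[of C] obtain_subset_with_card_n[OF le, of C] by (cases "f ` C = C") auto
  qed
  then obtain U where U: "\<And>C. C \<in> P \<Longrightarrow> U C \<subseteq> C" "\<And>C. C \<in> P \<Longrightarrow> card (U C) = k"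
    "\<And>C. C \<in> P \<Longrightarrow> f ` C = C \<Longrightarrow> f ` U C \<subseteq> U C"
    by metis
  \<comment> \<open>each pair of parts exchanged by \<open>f\<close> gets a leader, whose selection determines the other one\<close>
  define c where "c = (\<lambda>Q :: 'a set set. SOME D. D \<in> Q)"
  define T where "T = (\<lambda>C. if c {C, f ` C} = C then U C else f ` U (f ` C))"
  have c: "c {C, f ` C} = C \<or> c {C, f ` C} = f ` C" for C
    using someI[of "\<lambda>D. D \<in> {C, f ` C}" C] by (auto simp: c_def)
  have sub: "T C \<subseteq> C" if "C \<in> P" for C
    using U(1)[OF that] image_mono[OF U(1)[OF img[OF that]], of f] ff[OF that subset_refl]
    by (simp add: T_def)
  have card: "card (T C) = k" if "C \<in> P" for C
  proof -
    have "inj_on f (U (f ` C))"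
      using U(1)[OF img[OF that]] inv[OF img[OF that]]
      by (metis inj_on_inverseI subsetD)
    then show ?thesis
      using U(2)[OF that] U(2)[OF img[OF that]] by (simp add: T_def card_image)
  qed
  have image: "f ` T C \<subseteq> T (f ` C)" if C: "C \<in> P" for C
  proof (cases "f ` C = C")
    case True
    then show ?thesis using c[of C] U(3)[OF C] by (simp add: T_def)
  next
    case False
    \<comment> \<open>The leader depends only on the unordered pair, so \<open>C\<close> and its
      image agree on it, and exactly one of the two selections is the mirror image of the
      other's.\<close>
    have "{f ` C, f ` f ` C} = {C, f ` C}" using ff[OF C subset_refl] by auto
    then show ?thesis
      using c[of C] False ff[OF C] ff[OF C subset_refl] ff[OF img[OF C] U(1)[OF img[OF C]]]
      by (auto simp: T_def)
  qed
  have inter: "(\<Union>D \<in> P. T D) \<inter> C = T C" if C: "C \<in> P" for C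
  proof -
    have "D = C" if "D \<in> P" "x \<in> T D" "x \<in> C" for D x
      using that C sub[of D] disj by (auto simp: pairwise_def disjnt_iff)
    then show ?thesis using sub[OF C] C by blast
  qed
  show ?thesis
  proof (intro exI conjI ballI)
    show "(\<Union>D \<in> P. T D) \<subseteq> \<Union>P" using sub by blast
    show "f ` (\<Union>D \<in> P. T D) \<subseteq> (\<Union>D \<in> P. T D)" using image img by blast
    show "card ((\<Union>D \<in> P. T D) \<inter> C) = k" if "C \<in> P" for C
      using inter[OF that] card[OF that] by simp
  qed
qed

section \<open>Connection sets meeting every nontrivial coset equally\<close>

lemma (in group) inverse_closedI:
  assumes "S \<subseteq> carrier G" "\<And>x. x \<in> S \<Longrightarrow> inv x \<in> S"
  shows "inverse_closed G S"
proof -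
  have "x \<in> m_inv G ` S" if "x \<in> S" for x
    using assms that inv_inv[of x] by (metis image_eqI subsetD)
  then show ?thesis using assms(2) by (auto simp: inverse_closed_def)
qed

lemma inverse_closedD: "inverse_closed G S \<Longrightarrow> x \<in> S \<Longrightarrow> inv\<^bsub>G\<^esub> x \<in> S"
  by (auto simp: inverse_closed_def)

lemma (in group) inv_notin_subgroup:
  "subgroup H G \<Longrightarrow> g \<in> carrier G - H \<Longrightarrow> inv g \<in> carrier G - H"
  by (metis DiffD1 DiffD2 DiffI inv_closed inv_inv subgroup.m_inv_closed)

lemma (in group) nontrivial_rcosets:
  assumes H: "subgroup H G"
  shows "rcosets H - {H} = (\<lambda>g. H #> g) ` (carrier G - H)"
proof -
  have "H #> g \<noteq> H" if "g \<in> carrier G - H" for g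
    using that rcos_self[OF _ H, of g] by auto
  then show ?thesis using coset_join2[OF _ H] by (auto simp: RCOSETS_def)
qed

lemma (in group) nontrivial_rcoset_subset:
  assumes H: "subgroup H G" and C: "C \<in> rcosets H - {H}"
  shows "C \<subseteq> carrier G - H"
proof -
  have "C \<inter> H = {}"
    using C rcos_disjoint[OF H] subgroup.subgroup_in_rcosets[OF H is_group]
    by (auto simp: pairwise_def disjnt_iff)
  then show ?thesis using C rcosets_part_G[OF H] by blast
qed

text \<open>An unordered edge may be witnessed in either direction. The two quotients are inverse to
  each other, so inverse-closedness makes both directions equivalent.\<close>

lemma (in group) neighbours_cayley_graph:
  assumes S: "S \<subseteq> carrier G" "inverse_closed G S" and v: "v \<in> carrier G"
  shows "neighbours (cayley_graph G S) v = {u \<in> carrier G. u \<otimes> inv v \<in> S}"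
proof -
  have "u \<otimes> inv v \<in> S" if "v \<otimes> inv u \<in> S" "u \<in> carrier G" for u
    using inverse_closedD[OF S(2) that(1)] that(2) v by (simp add: inv_mult_group)
  then show ?thesis
    using v by (auto simp: neighbours_def cayley_graph_def doubleton_eq_iff)
qed

text \<open>Right translation by \<open>inv v\<close> is injective and carries the neighbours of
  \<open>v\<close> in \<open>H\<close> onto the part of \<open>S\<close> in a coset.\<close>

lemma (in group) card_neighbours_subgroup:
  assumes S: "S \<subseteq> carrier G" "inverse_closed G S" and H: "subgroup H G" and v: "v \<in> carrier G"
  shows "card (neighbours (cayley_graph G S) v \<inter> H) = card (S \<inter> (H #> inv v))"
proof -
  have HG: "H \<subseteq> carrier G" using H by (rule subgroup.subset)
  have "S \<inter> (H #> inv v) = (\<lambda>u. u \<otimes> inv v) ` (neighbours (cayley_graph G S) v \<inter> H)"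
    using HG by (auto simp: neighbours_cayley_graph[OF S v] r_coset_def)
  moreover have "inj_on (\<lambda>u. u \<otimes> inv v) (neighbours (cayley_graph G S) v \<inter> H)"
    using HG v by (intro inj_onI) (auto simp: subset_iff)
  ultimately show ?thesis by (simp add: card_image)
qed

text \<open>This criterion replaces the graph by cosets: as \<open>v\<close> runs through the
  vertices outside \<open>H\<close>, \<open>H #> inv v\<close> runs through the nontrivial
  cosets.\<close>

lemma (in group) group_zero_regular_set_subgroup_iff:
  assumes H: "subgroup H G" "H \<noteq> carrier G"
  shows "group_zero_regular_set G k H \<longleftrightarrow>
    (\<exists>S \<subseteq> carrier G - H. inverse_closed G S \<and> (\<forall>C \<in> rcosets H - {H}. card (S \<inter> C) = k))"
    (is "_ \<longleftrightarrow> ?R")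
proof
  have HG: "H \<subseteq> carrier G" using H(1) by (rule subgroup.subset)
  note inv_out = inv_notin_subgroup[OF H(1)]
  note cosets = nontrivial_rcosets[OF H(1)]
  {
    assume "group_zero_regular_set G k H"
    then obtain S where S: "S \<subseteq> carrier G - {\<one>}" "inverse_closed G S"
      and reg: "zero_regular_set (cayley_graph G S) k H"
      unfolding group_zero_regular_set_def by blast
    have SG: "S \<subseteq> carrier G" using S(1) by blast
    \<comment> \<open>The neighbours of the identity are the elements of \<open>S\<close>, so this
      vertex alone forces \<open>S\<close> to avoid \<open>H\<close>.\<close>
    have "neighbours (cayley_graph G S) \<one> \<inter> H = {}"
      using reg subgroup.one_closed[OF H(1)] by (simp add: zero_regular_set_def)
    then have "S \<subseteq> carrier G - H"
      using SG by (force simp: neighbours_cayley_graph[OF SG S(2)])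
    moreover have "card (S \<inter> (H #> g)) = k" if g: "g \<in> carrier G - H" for g
      using reg inv_out[OF g] card_neighbours_subgroup[OF SG S(2) H(1), of "inv g"] g
      by (simp add: zero_regular_set_def cayley_graph_def)
    ultimately show ?R using S(2) unfolding cosets by blast
  next
    assume ?R
    then obtain S where S: "S \<subseteq> carrier G - H" "inverse_closed G S"
      and card: "\<forall>g \<in> carrier G - H. card (S \<inter> (H #> g)) = k"
      unfolding cosets by blast
    have SG: "S \<subseteq> carrier G" "S \<subseteq> carrier G - {\<one>}"
      using S(1) subgroup.one_closed[OF H(1)] by auto
    have "neighbours (cayley_graph G S) v \<inter> H = {}" if v: "v \<in> H" for v
    proof -
      have "u \<otimes> inv v \<notin> S" if "u \<in> H" for u
        using S(1) subgroup.m_closed[OF H(1) that subgroup.m_inv_closed[OF H(1) v]] by blast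
      then show ?thesis using v HG by (auto simp: neighbours_cayley_graph[OF SG(1) S(2)])
    qed
    moreover have "card (neighbours (cayley_graph G S) v \<inter> H) = k" if v: "v \<in> carrier G - H" for v
      using bspec[OF card inv_out[OF v]] card_neighbours_subgroup[OF SG(1) S(2) H(1), of v] v by simp
    ultimately have "zero_regular_set (cayley_graph G S) k H"
      using H HG subgroup.one_closed[OF H(1)]
      by (auto simp: zero_regular_set_def cayley_graph_def)
    then show "group_zero_regular_set G k H"
      using SG(2) S(2) by (auto simp: group_zero_regular_set_def)
  }
qed

section \<open>Squares in finite groups\<close>

text \<open>Without an involution, inversion would pair off the non-identity elements, whose number
  is odd.\<close>

lemma (in group) exists_involution_if_even_order:
  assumes "finite (carrier G)" "even (order G)"
  shows "\<exists>x \<in> carrier G - {\<one>}. x \<otimes> x = \<one>"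
proof (rule ccontr)
  assume none: "\<not> ?thesis"
  have "even (card (carrier G - {\<one>}))"
  proof (rule even_card_fixpoint_free_involution[where f = "m_inv G"])
    fix x assume x: "x \<in> carrier G - {\<one>}"
    then have "inv x \<noteq> x" using none r_inv[of x] by (metis DiffD1)
    then show "inv x \<in> carrier G - {\<one>} \<and> inv (inv x) = x \<and> inv x \<noteq> x"
      using x by (auto simp: inv_eq_1_iff)
  qed (use assms(1) in simp)
  moreover have "order G > 0" using assms(1) order_gt_0_iff_finite by blast
  ultimately show False using assms by (simp add: order_def)
qed

lemma (in group) square_eq_one_odd_order:
  assumes "odd (order G)" "x \<in> carrier G" "x \<otimes> x = \<one>"
  shows "x = \<one>"
proof -
  have "x [^] (2::nat) = \<one>" using assms(2,3) by (simp add: numeral_2_eq_2)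
  then have "ord x dvd 2" using assms(2) pow_eq_id by blast
  moreover have "odd (ord x)"
    using assms(1) ord_dvd_group_order[OF assms(2)] by (meson dvd_trans)
  moreover have "ord x \<le> 2" using \<open>ord x dvd 2\<close> by (rule dvd_imp_le) simp
  moreover have "d = 1" if "odd d" "d \<le> 2" for d :: nat using that by presburger
  ultimately have "ord x = 1" by blast
  then show ?thesis using assms(2) ord_eq_1 by blast
qed

context normal
begin

text \<open>The coset of \<open>g\<close> squares to the identity of the quotient, a group of odd
  order, and is therefore trivial.\<close>

lemma mem_of_square_mem_if_odd_index:
  assumes "odd (card (rcosets H))" "g \<in> carrier G" "g \<otimes> g \<in> H"
  shows "g \<in> H"
proof -
  interpret Q: group "G Mod H" by (rule factorgroup_is_group)
  have "H #> g = H"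
    using Q.square_eq_one_odd_order[of "H #> g"] assms rcosetsI[OF subset assms(2)]
      rcos_sum[OF assms(2,2)] coset_join2[of "g \<otimes> g" H] is_subgroup
    by (simp add: FactGroup_def order_def)
  then show ?thesis using assms(2) coset_join1 is_subgroup subset by blast
qed

text \<open>Any representative of an involution in the quotient group has the required
  property.\<close>

lemma exists_square_mem_if_even_index:
  assumes "finite (rcosets H)" "even (card (rcosets H))"
  shows "\<exists>g \<in> carrier G - H. g \<otimes> g \<in> H"
proof -
  interpret Q: group "G Mod H" by (rule factorgroup_is_group)
  obtain C where C: "C \<in> rcosets H" "C \<noteq> H" "C <#> C = H"
    using Q.exists_involution_if_even_order assms by (auto simp: FactGroup_def order_def)
  then obtain g where g: "g \<in> carrier G" "C = H #> g" by (auto simp: RCOSETS_def)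
  have "H #> (g \<otimes> g) = H" using C(3) rcos_sum[OF g(1) g(1)] g(2) by simp
  then have "g \<otimes> g \<in> H" using g(1) coset_join1 is_subgroup subset by blast
  moreover have "g \<notin> H" using C(2) g coset_join2 is_subgroup by blast
  ultimately show ?thesis using g(1) by blast
qed

end

text \<open>With \<open>card H = 2 * j + 1\<close> and \<open>h = (g \<otimes> g) [^] j\<close>,
  commutativity turns the square of \<open>h \<otimes> g\<close> into
  \<open>(g \<otimes> g) [^] card H\<close>, which is the identity because
  \<open>g \<otimes> g\<close> lies in \<open>H\<close>.\<close>

lemma (in comm_group) exists_involution_in_coset_if_odd:
  assumes H: "subgroup H G" "odd (card H)" and g: "g \<in> carrier G" "g \<otimes> g \<in> H"
  shows "\<exists>h \<in> H. (h \<otimes> g) \<otimes> (h \<otimes> g) = \<one>"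
proof -
  interpret H: subgroup H G by (rule H(1))
  interpret K: group "G\<lparr>carrier := H\<rparr>" by (rule H.subgroup_is_group) (rule is_group)
  obtain j where j: "card H = 2 * j + 1" using H(2) oddE by blast
  define h where "h = (g \<otimes> g) [^] j"
  have hH: "h \<in> H" using K.nat_pow_closed[of "g \<otimes> g" j] g(2)
    by (simp add: h_def nat_pow_consistent[symmetric])
  have "(g \<otimes> g) [^] card H = \<one>"
    using K.pow_order_eq_1[of "g \<otimes> g"] g(2) by (simp add: order_def nat_pow_consistent[symmetric])
  then have "(h \<otimes> h) \<otimes> (g \<otimes> g) = \<one>"
    using g(1) by (simp add: h_def j nat_pow_mult mult_2[symmetric])
  moreover have "(h \<otimes> g) \<otimes> (h \<otimes> g) = (h \<otimes> h) \<otimes> (g \<otimes> g)"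
    using hH g(1) by (simp add: m_ac)
  ultimately have "(h \<otimes> g) \<otimes> (h \<otimes> g) = \<one>" by simp
  then show ?thesis using hH by blast
qed

text \<open>If \<open>a [^] i\<close> is an involution with \<open>i < ord a\<close>, then
  \<open>2 * i\<close> is a positive multiple of \<open>ord a\<close> below
  \<open>2 * ord a\<close>, so it equals \<open>ord a\<close> and \<open>i\<close> is
  determined.\<close>

lemma (in group) involution_unique_in_cyclic:
  assumes "finite (carrier G)" "a \<in> carrier G"
    and "x \<in> generate G {a}" "x \<otimes> x = \<one>" "x \<noteq> \<one>"
    and "y \<in> generate G {a}" "y \<otimes> y = \<one>" "y \<noteq> \<one>"
  shows "x = y"
proof -
  have "z = a [^] (ord a div 2)" if z: "z \<in> generate G {a}" "z \<otimes> z = \<one>" "z \<noteq> \<one>" for z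
  proof -
    have "z \<in> {a [^] x | x. x \<in> {0..ord a - 1}}"
      using z(1) generate_pow_on_finite_carrier[OF assms(1,2)] ord_elems[OF assms(1,2)] by metis
    then obtain i where i: "z = a [^] i" "i \<le> ord a - 1" by auto
    \<comment> \<open>Positivity makes the bound \<open>ord a - 1\<close>, a subtraction of
      naturals, mean that \<open>i\<close> is less than \<open>ord a\<close>.\<close>
    have pos: "ord a > 0" using ord_ge_1[OF assms(1,2)] by simp
    have "a [^] (2 * i) = \<one>" using z(2) i assms(2) by (simp add: nat_pow_mult mult_2)
    then have "ord a dvd 2 * i" using pow_eq_id assms(2) by blast
    then obtain q where q: "2 * i = ord a * q" by blast
    have "i \<noteq> 0" using i(1) z(3) by (metis nat_pow_0)
    then have "q \<noteq> 0" using q by (metis mult_0_right mult_eq_0_iff zero_neq_numeral)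
    moreover have "ord a * q < ord a * 2" using q i(2) pos by linarith
    then have "q < 2" by simp
    ultimately have "q = 1" by linarith
    then have "ord a = 2 * i" using q by simp
    then have "i = ord a div 2" by simp
    then show ?thesis using i(1) by simp
  qed
  then show ?thesis using assms(3-8) by metis
qed

section \<open>Dihedral groups\<close>

text \<open>The set \<open>A\<close> plays the role of the rotations: an abelian subgroup of index
  at most two whose complement consists of involutions. Cyclicity of \<open>A\<close> is left out,
  since only the necessity of the parity condition relies on it.\<close>

locale generalized_dihedral = group G for G (structure) +
  fixes A
  assumes finite_carrier: "finite (carrier G)"
    and rotations: "subgroup A G"
    and rotations_comm: "\<And>x y. x \<in> A \<Longrightarrow> y \<in> A \<Longrightarrow> x \<otimes> y = y \<otimes> x"
    and reflection_square: "\<And>x. x \<in> carrier G - A \<Longrightarrow> x \<otimes> x = \<one>"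
    and reflection_mult: "\<And>x y. x \<in> carrier G - A \<Longrightarrow> y \<in> carrier G - A \<Longrightarrow> x \<otimes> y \<in> A"
begin

abbreviation rotation_group where "rotation_group \<equiv> G\<lparr>carrier := A\<rparr>"

lemma A_sub: "A \<subseteq> carrier G"
  using rotations by (rule subgroup.subset)

lemma reflection_inv: "x \<in> carrier G - A \<Longrightarrow> inv x = x"
  using reflection_square by (metis DiffD1 inv_equality)

lemma comm_group_rotations: "comm_group rotation_group"
  using rotations_comm
  by (intro group.group_comm_groupI subgroup.subgroup_is_group rotations is_group) simp

lemma reflection_mult_rotation:
  assumes "c \<in> carrier G - A" "x \<in> A"
  shows "c \<otimes> x \<in> carrier G - A"
proof -
  have xG: "x \<in> carrier G" using assms(2) A_sub by blast
  have "c = (c \<otimes> x) \<otimes> inv x" using assms(1) xG by (simp add: m_assoc)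
  then have "c \<otimes> x \<notin> A"
    using assms rotations by (metis DiffD2 subgroup.m_closed subgroup.m_inv_closed)
  then show ?thesis using assms(1) xG by simp
qed

section \<open>Subgroups consisting of rotations\<close>

lemma normal_rotation_group:
  assumes "subgroup H G" "H \<subseteq> A"
  shows "H \<lhd> rotation_group"
proof -
  interpret K: comm_group rotation_group by (rule comm_group_rotations)
  show ?thesis using assms rotations by (intro K.subgroup_imp_normal subgroup_incl)
qed

lemma card_rcosets_rotations:
  assumes "subgroup H G" "H \<subseteq> A"
  shows "card (rcosets\<^bsub>rotation_group\<^esub> H) = card A div card H"
proof -
  interpret K: comm_group rotation_group by (rule comm_group_rotations)
  have "card (rcosets\<^bsub>rotation_group\<^esub> H) * card H = card A"
    using K.lagrange[of H] normal_rotation_group[OF assms]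
    by (simp add: normal_def order_def)
  moreover have "card H > 0"
    using subgroup.one_closed[OF assms(1)] subgroup.subset[OF assms(1)] finite_carrier
    by (metis card_gt_0_iff empty_iff finite_subset)
  ultimately show ?thesis by (metis div_mult_self_is_m)
qed

text \<open>For a reflection \<open>x\<close> and a rotation \<open>h\<close>, the product
  \<open>x \<otimes> h\<close> is a reflection and squares to the identity. Hence conjugation by
  \<open>x\<close> inverts \<open>h\<close>, while conjugation by a rotation fixes it.\<close>

lemma normal_rotations:
  assumes H: "subgroup H G" "H \<subseteq> A"
  shows "H \<lhd> G"
proof (rule normal_invI[OF H(1)])
  fix x h assume x: "x \<in> carrier G" and h: "h \<in> H"
  have hG: "h \<in> carrier G" "h \<in> A" using h H A_sub by auto
  show "x \<otimes> h \<otimes> inv x \<in> H"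
  proof (cases "x \<in> A")
    case True
    then show ?thesis using rotations_comm[OF True hG(2)] h hG(1) x by (simp add: m_assoc)
  next
    case False
    have "(x \<otimes> h) \<otimes> (x \<otimes> h) = \<one>"
      using False x hG(2) by (intro reflection_square reflection_mult_rotation) auto
    then have "(x \<otimes> h \<otimes> x) \<otimes> h = \<one>" using x hG(1) by (simp add: m_assoc)
    then have "x \<otimes> h \<otimes> x = inv h" using x hG(1) by (intro inv_equality[symmetric]) auto
    then show ?thesis
      using reflection_inv[of x] False x subgroup.m_inv_closed[OF H(1) h] by simp
  qed
qed

text \<open>Inverting a right coset gives a left coset, which normality turns back into a right
  coset. So inversion permutes the right cosets.\<close>

lemma inv_image_rcoset:
  assumes "subgroup H G" "H \<subseteq> A" "g \<in> carrier G"
  shows "m_inv G ` (H #> g) = H #> inv g"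
proof -
  have "set_inv (H #> g) = m_inv G ` (H #> g)" by (auto simp: SET_INV_def)
  then show ?thesis using normal.rcos_inv[OF normal_rotations[OF assms(1,2)] assms(3)] by simp
qed

text \<open>Inversion permutes the nontrivial cosets, so \<open>invariant_selection\<close> applies.
  For odd \<open>k\<close> each self-inverse coset must contain an involution: a reflection is one,
  and for a coset of rotations the assumption \<open>odd\<close> either yields one or rules the
  coset out.\<close>

lemma regular_set_rotations:
  assumes H: "subgroup H G" "H \<subseteq> A" "H \<noteq> carrier G" and k: "k \<le> card H"
    and odd: "odd k \<Longrightarrow> odd (card H) \<or> odd (card A div card H)"
  shows "group_zero_regular_set G k H"
proof -
  interpret K: comm_group rotation_group by (rule comm_group_rotations)
  define P where "P = rcosets H - {H}"
  have HG: "H \<subseteq> carrier G" using H(1) by (rule subgroup.subset)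
  have P: "P = (\<lambda>g. H #> g) ` (carrier G - H)"
    unfolding P_def by (rule nontrivial_rcosets[OF H(1)])
  have CG: "C \<subseteq> carrier G - H" if "C \<in> P" for C
    using that unfolding P_def by (rule nontrivial_rcoset_subset[OF H(1)])
  have cardC: "card C = card H" if "C \<in> P" for C
    using that card_rcosets_equal[of C H] HG by (auto simp: P_def)
  have "\<exists>S \<subseteq> \<Union>P. m_inv G ` S \<subseteq> S \<and> (\<forall>C \<in> P. card (S \<inter> C) = k)"
  proof (rule invariant_selection)
    show "pairwise disjnt P"
      using rcos_disjoint[OF H(1)] by (rule pairwise_subset) (auto simp: P_def)
    show "m_inv G ` C \<in> P" if "C \<in> P" for C
      using that inv_image_rcoset[OF H(1,2)] inv_notin_subgroup[OF H(1)] by (auto simp: P)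
    show "k \<le> card C" if "C \<in> P" for C
      using cardC[OF that] k by simp
    show "inv (inv x) = x" if "C \<in> P" "x \<in> C" for C x
      using CG that by (intro inv_inv) blast
  next
    fix C assume C: "C \<in> P" "m_inv G ` C = C"
    obtain g where g: "g \<in> carrier G - H" "C = H #> g" using C(1) P by blast
    have gC: "g \<in> C" using g rcos_self[OF _ H(1)] by simp
    \<comment> \<open>Writing \<open>inv g\<close> as \<open>h \<otimes> g\<close> shows that the
      square of \<open>g\<close> lies in \<open>H\<close>.\<close>
    then have "inv g \<in> H #> g" using C(2) g(2) by blast
    then obtain h where h: "h \<in> H" "inv g = h \<otimes> g" by (auto simp: r_coset_def)
    have "h \<otimes> (g \<otimes> g) = \<one>"
      using h g(1) HG by (metis DiffD1 l_inv m_assoc subsetD)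
    then have "g \<otimes> g = inv h"
      using h(1) g(1) HG by (metis DiffD1 inv_equality inv_inv m_closed subsetD)
    then have gg: "g \<otimes> g \<in> H" using subgroup.m_inv_closed[OF H(1) h(1)] by simp
    show "\<exists>B \<subseteq> C. m_inv G ` B \<subseteq> B \<and> card B = k"
    proof (rule invariant_subset_card)
      show "finite C" using CG[OF C(1)] finite_carrier finite_subset by blast
      show "inv x \<in> C \<and> inv (inv x) = x" if "x \<in> C" for x
        using that C CG[OF C(1)] by auto
      show "k \<le> card C" using cardC[OF C(1)] k by simp
      assume "odd k"
      show "\<exists>x \<in> C. inv x = x"
      proof (cases "g \<in> A")
        case False
        then show ?thesis using reflection_inv g(1) gC by blast
      next
        case gA: True
        have nH: "H \<lhd> rotation_group" by (rule normal_rotation_group[OF H(1,2)])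
        \<comment> \<open>Otherwise \<open>H\<close> has odd index in \<open>A\<close>, and
          \<open>g\<close>, whose square lies in \<open>H\<close>, would itself lie in
          \<open>H\<close>.\<close>
        have "odd (card H)"
        proof (rule ccontr)
          assume "\<not> odd (card H)"
          then have "odd (card (rcosets\<^bsub>rotation_group\<^esub> H))"
            using odd[OF \<open>odd k\<close>] card_rcosets_rotations[OF H(1,2)] by simp
          then have "g \<in> H"
            using normal.mem_of_square_mem_if_odd_index[OF nH, of g] gA gg by simp
          then show False using g(1) by simp
        qed
        then obtain h' where h': "h' \<in> H" "(h' \<otimes> g) \<otimes> (h' \<otimes> g) = \<one>"
          using K.exists_involution_in_coset_if_odd[of H g] nH gA gg by (auto simp: normal_def)
        have "h' \<otimes> g \<in> C" using h'(1) g(2) by (auto simp: r_coset_def)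
        moreover have "inv (h' \<otimes> g) = h' \<otimes> g"
          using h' g(1) HG by (intro inv_equality) auto
        ultimately show ?thesis by blast
      qed
    qed
  qed
  then obtain S where S: "S \<subseteq> \<Union>P" "m_inv G ` S \<subseteq> S" "\<forall>C \<in> P. card (S \<inter> C) = k"
    by blast
  have "S \<subseteq> carrier G - H" using S(1) CG by blast
  moreover have "inverse_closed G S"
    using S(1,2) CG by (intro inverse_closedI) blast+
  ultimately show ?thesis
    using S(3) unfolding P_def group_zero_regular_set_subgroup_iff[OF H(1,3)] by blast
qed

section \<open>Subgroups containing a reflection\<close>

lemma card_rcoset_reflections:
  assumes H: "subgroup H G" "\<not> H \<subseteq> A" and g: "g \<in> carrier G"
  shows "card ((H #> g) \<inter> A) = card H div 2" "card ((H #> g) - A) = card H div 2"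
proof -
  have HG: "H \<subseteq> carrier G" using H(1) by (rule subgroup.subset)
  obtain c where c: "c \<in> H" "c \<in> carrier G - A" using H(2) HG by blast
  let ?C = "H #> g"
  have CG: "?C \<subseteq> carrier G" using r_coset_subset_G[OF HG g] .
  have finC: "finite ?C" using CG finite_carrier finite_subset by blast
  have cC: "c \<otimes> x \<in> ?C" if "x \<in> ?C" for x
  proof -
    from that obtain h where h: "h \<in> H" "x = h \<otimes> g" by (auto simp: r_coset_def)
    then have "c \<otimes> x = (c \<otimes> h) \<otimes> g" using c(2) g HG by (simp add: m_assoc subset_iff)
    then show ?thesis using subgroup.m_closed[OF H(1) c(1) h(1)] by (auto simp: r_coset_def)
  qed
  have cc: "c \<otimes> (c \<otimes> x) = x" if "x \<in> ?C" for x
    using that CG c(2) reflection_square[OF c(2)] by (metis DiffD1 l_one m_assoc subsetD)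
  \<comment> \<open>Left multiplication by \<open>c\<close> preserves the coset because
    \<open>c\<close> lies in \<open>H\<close>, is its own inverse, and exchanges rotations with
    reflections.\<close>
  have "bij_betw (\<lambda>x. c \<otimes> x) (?C \<inter> A) (?C - A)"
    using cC cc c(2) reflection_mult_rotation reflection_mult CG
    by (intro bij_betwI[where g = "\<lambda>x. c \<otimes> x"]) auto
  then have eq: "card (?C \<inter> A) = card (?C - A)" by (rule bij_betw_same_card)
  have "card H = card ?C"
    using card_rcosets_equal[OF rcosetsI[OF HG g] HG] by simp
  also have "\<dots> = card (?C \<inter> A) + card (?C - A)"
    using card_Int_Diff[OF finC] .
  finally show "card (?C \<inter> A) = card H div 2" "card (?C - A) = card H div 2"
    using eq by simp_all
qed

text \<open>Every coset has \<open>m\<close> rotations and \<open>m\<close> reflections. Up to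
  \<open>m\<close> elements can be reflections only; beyond that, all \<open>m\<close> rotations of
  each nontrivial coset are joined by \<open>k - m\<close> of its reflections.\<close>

lemma regular_set_not_rotations:
  assumes H: "subgroup H G" "\<not> H \<subseteq> A" "H \<noteq> carrier G" and k: "k \<le> card H"
  shows "group_zero_regular_set G k H"
proof -
  define P where "P = rcosets H - {H}"
  define m where "m = card H div 2"
  \<comment> \<open>Taking no rotations or all those outside \<open>H\<close> keeps the choice
    inverse-closed. The reflections added later are their own inverses and can be chosen in each
    coset independently.\<close>
  define R where "R = (if k \<le> m then {} else A - H)"
  have HG: "H \<subseteq> carrier G" using H(1) by (rule subgroup.subset)
  have P: "P = (\<lambda>g. H #> g) ` (carrier G - H)"
    unfolding P_def by (rule nontrivial_rcosets[OF H(1)])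
  have CG: "C \<subseteq> carrier G - H" if "C \<in> P" for C
    using that unfolding P_def by (rule nontrivial_rcoset_subset[OF H(1)])
  \<comment> \<open>Applied to \<open>H\<close> itself as the coset of the identity, the count of
    reflections shows that halving \<open>card H\<close> is exact.\<close>
  have "2 * m = card H"
    using card_rcoset_reflections[OF H(1,2) one_closed] card_Int_Diff[of "H #> \<one>" A] HG
      finite_subset[OF HG finite_carrier] by (simp add: m_def)
  \<comment> \<open>The first conjunct says that \<open>C\<close> has enough reflections to complete
    the selection; the second keeps the natural subtraction from truncating.\<close>
  then have km: "k - card (R \<inter> C) \<le> card (C - A) \<and> card (R \<inter> C) \<le> k" if "C \<in> P" for C
  proof -
    have "(A - H) \<inter> C = C \<inter> A" using CG[OF that] by auto
    then show ?thesis
      using that P card_rcoset_reflections[OF H(1,2)] k \<open>2 * m = card H\<close>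
      by (auto simp: R_def m_def)
  qed
  have "\<forall>C \<in> P. \<exists>B \<subseteq> C - A. card B = k - card (R \<inter> C)"
    using km obtain_subset_with_card_n by metis
  then obtain U where U: "\<And>C. C \<in> P \<Longrightarrow> U C \<subseteq> C - A"
    "\<And>C. C \<in> P \<Longrightarrow> card (U C) = k - card (R \<inter> C)"
    by metis
  define S where "S = R \<union> (\<Union>C \<in> P. U C)"
  have RA: "R \<subseteq> A - H" by (simp add: R_def)
  have SG: "S \<subseteq> carrier G - H"
    using RA A_sub U(1) CG unfolding S_def by blast
  have "inv x \<in> S" if "x \<in> S" for x
  proof (cases "x \<in> A")
    case True
    then have "x \<in> R" "k > m" using that U(1) by (auto simp: S_def R_def split: if_splits)
    moreover have "inv x \<in> A" using subgroup.m_inv_closed[OF rotations True] .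
    moreover have "inv x \<notin> H"
      using that SG subgroup.m_inv_closed[OF H(1)] by (metis DiffD1 DiffD2 inv_inv subsetD)
    ultimately show ?thesis by (simp add: S_def R_def)
  next
    case False
    then show ?thesis using reflection_inv[of x] that SG by auto
  qed
  then have "inverse_closed G S" using SG by (intro inverse_closedI) auto
  moreover have "card (S \<inter> C) = k" if C: "C \<in> P" for C
  proof -
    have "D = C" if "D \<in> P" "x \<in> U D" "x \<in> C" for D x
      using that C U(1)[OF that(1)] rcos_disjoint[OF H(1)]
      by (auto simp: P_def pairwise_def disjnt_iff)
    then have "S \<inter> C = (R \<inter> C) \<union> U C" using C U(1)[OF C] by (auto simp: S_def)
    moreover have "finite C" using CG[OF C] finite_carrier finite_subset by blast
    moreover have "R \<inter> C \<inter> U C = {}" using U(1)[OF C] RA by blast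
    ultimately have "card (S \<inter> C) = card (R \<inter> C) + card (U C)"
      using U(1)[OF C] by (metis card_Un_disjoint finite_Diff finite_Int finite_subset)
    then show ?thesis using U(2)[OF C] km[OF C] by simp
  qed
  ultimately show ?thesis
    using SG unfolding P_def group_zero_regular_set_subgroup_iff[OF H(1,3)] by blast
qed

section \<open>Necessity of the parity condition\<close>

lemma even_if_regular_set_rotations:
  assumes H: "subgroup H G" "H \<subseteq> A" "H \<noteq> carrier G"
    and cyclic: "a \<in> carrier G" "A = generate G {a}"
    and reg: "group_zero_regular_set G k H"
    and ev: "even (card H)" "even (card A div card H)"
  shows "even k"
proof -
  interpret K: comm_group rotation_group by (rule comm_group_rotations)
  have HG: "H \<subseteq> carrier G" using H(1) by (rule subgroup.subset)
  have finH: "finite H" using HG finite_carrier finite_subset by blast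
  \<comment> \<open>By cyclicity, \<open>z\<close> is the only involution of \<open>A\<close>, so no
    rotation outside \<open>H\<close> is its own inverse.\<close>
  have "\<exists>z \<in> H - {\<one>}. z \<otimes> z = \<one>"
    using group.exists_involution_if_even_order[OF subgroup.subgroup_is_group[OF H(1) is_group]]
      finH ev(1) by (simp add: order_def)
  then obtain z where z: "z \<in> H" "z \<noteq> \<one>" "z \<otimes> z = \<one>" by blast
  have nH: "H \<lhd> rotation_group" by (rule normal_rotation_group[OF H(1,2)])
  have "finite (rcosets\<^bsub>rotation_group\<^esub> H)"
    using K.rcosets_part_G[OF normal.axioms(1)[OF nH]] finite_subset[OF A_sub finite_carrier]
    by (intro finite_UnionD) simp
  then obtain g where g: "g \<in> A - H" "g \<otimes> g \<in> H"
    using normal.exists_square_mem_if_even_index[OF nH] ev(2) card_rcosets_rotations[OF H(1,2)]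
    by auto
  have gG: "g \<in> carrier G - H" using g A_sub by blast
  obtain S where S: "S \<subseteq> carrier G - H" "inverse_closed G S"
    and card: "card (S \<inter> (H #> g)) = k"
    using reg gG
    unfolding group_zero_regular_set_subgroup_iff[OF H(1,3)] nontrivial_rcosets[OF H(1)] by blast
  \<comment> \<open>This places \<open>inv g\<close> in the coset of \<open>g\<close>. Inversion
    thus acts on \<open>S \<inter> (H #> g)\<close>, without fixed points, and \<open>k\<close> is
    even.\<close>
  have "inv g = inv (g \<otimes> g) \<otimes> g" using gG by (simp add: inv_mult_group m_assoc)
  then have "inv g \<in> H #> g"
    using subgroup.m_inv_closed[OF H(1) g(2)] by (auto simp: r_coset_def)
  then have coset: "m_inv G ` (H #> g) = H #> g"
    using inv_image_rcoset[OF H(1,2)] repr_independence[of "inv g" H g] H(1) gG by simp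
  have "even (card (S \<inter> (H #> g)))"
  proof (rule even_card_fixpoint_free_involution[where f = "m_inv G"])
    show "finite (S \<inter> (H #> g))"
      using S(1) finite_carrier by (meson Diff_subset finite_Int finite_subset)
    fix x assume x: "x \<in> S \<inter> (H #> g)"
    then have xG: "x \<in> carrier G" "x \<notin> H" using S(1) by auto
    have xA: "x \<in> A"
      using x g H(2) subgroup.m_closed[OF rotations] by (auto simp: r_coset_def)
    have "inv x \<noteq> x"
    proof
      assume "inv x = x"
      then have "x \<otimes> x = \<one>" using r_inv[OF xG(1)] by simp
      moreover have "x \<noteq> \<one>" using xG(2) subgroup.one_closed[OF H(1)] by auto
      ultimately have "x = z"
        using involution_unique_in_cyclic[OF finite_carrier cyclic(1)] xA z H(2) cyclic(2) by blast
      then show False using z(1) xG(2) by simp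
    qed
    then show "inv x \<in> S \<inter> (H #> g) \<and> inv (inv x) = x \<and> inv x \<noteq> x"
      using x xG(1) inverse_closedD[OF S(2)] coset by auto
  qed
  then show ?thesis using card by simp
qed

end

section \<open>Dihedral groups as instances of the locale\<close>

lemma dihedral_group_rotations:
  assumes "dihedral_group G n a b" "n > 0"
  shows "generalized_dihedral G (generate G {a})" "card (generate G {a}) = n"
proof -
  interpret group G using assms(1) by (simp add: dihedral_group_def)
  let ?A = "generate G {a}" and ?B = "generate G {a} #>\<^bsub>G\<^esub> b"
  have car [simp]: "a \<in> carrier G" "b \<in> carrier G" and gen: "generate G {a, b} = carrier G"
    and an: "a [^]\<^bsub>G\<^esub> n = \<one>\<^bsub>G\<^esub>" and bb: "b \<otimes>\<^bsub>G\<^esub> b = \<one>\<^bsub>G\<^esub>"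
    and bab: "b \<otimes>\<^bsub>G\<^esub> a \<otimes>\<^bsub>G\<^esub> b = inv\<^bsub>G\<^esub> a" and ord: "order G = 2 * n"
    using assms(1) by (auto simp: dihedral_group_def numeral_2_eq_2)
  have fin: "finite (carrier G)"
    using ord assms(2) order_gt_0_iff_finite by simp
  have A: "subgroup ?A G" by (intro generate_is_subgroup) simp
  have AG: "x \<in> carrier G" if "x \<in> ?A" for x using subgroup.mem_carrier[OF A that] .
  have pow: "\<exists>i::nat. x = a [^]\<^bsub>G\<^esub> i" if "x \<in> ?A" for x
    using that generate_pow_on_finite_carrier[OF fin car(1)] by blast
  have bb_left: "b \<otimes>\<^bsub>G\<^esub> (b \<otimes>\<^bsub>G\<^esub> x) = x" if "x \<in> carrier G" for x
    using that bb by (simp add: m_assoc[symmetric])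
  have conj_pow: "b \<otimes>\<^bsub>G\<^esub> (a [^]\<^bsub>G\<^esub> i \<otimes>\<^bsub>G\<^esub> b) = inv\<^bsub>G\<^esub> (a [^]\<^bsub>G\<^esub> i)" for i :: nat
  proof (induction i)
    case 0
    show ?case using bb by simp
  next
    case (Suc i)
    \<comment> \<open>The identity, written as \<open>b\<close> times \<open>b\<close>, is inserted
      between the first factor \<open>a\<close> and the remaining power.\<close>
    have "b \<otimes>\<^bsub>G\<^esub> (a [^]\<^bsub>G\<^esub> Suc i \<otimes>\<^bsub>G\<^esub> b)
        = (b \<otimes>\<^bsub>G\<^esub> a \<otimes>\<^bsub>G\<^esub> b) \<otimes>\<^bsub>G\<^esub> (b \<otimes>\<^bsub>G\<^esub> (a [^]\<^bsub>G\<^esub> i \<otimes>\<^bsub>G\<^esub> b))"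
      unfolding nat_pow_Suc2[OF car(1)] by (simp add: m_assoc bb_left)
    also have "\<dots> = inv\<^bsub>G\<^esub> (a [^]\<^bsub>G\<^esub> Suc i)" by (simp add: Suc bab inv_mult_group)
    finally show ?case .
  qed
  have conj: "b \<otimes>\<^bsub>G\<^esub> (x \<otimes>\<^bsub>G\<^esub> b) = inv\<^bsub>G\<^esub> x" if "x \<in> ?A" for x
    using pow[OF that] conj_pow by blast
  have swap: "b \<otimes>\<^bsub>G\<^esub> x = inv\<^bsub>G\<^esub> x \<otimes>\<^bsub>G\<^esub> b" if "x \<in> ?A" for x
    using conj[OF that] AG[OF that] bb by (metis car(2) m_assoc m_closed r_one)
  have mult: "(x \<otimes>\<^bsub>G\<^esub> b) \<otimes>\<^bsub>G\<^esub> (y \<otimes>\<^bsub>G\<^esub> b) = x \<otimes>\<^bsub>G\<^esub> inv\<^bsub>G\<^esub> y" if "x \<in> ?A" "y \<in> ?A" for x y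
    using that conj[OF that(2)] AG by (simp add: m_assoc)
  have mult': "(x \<otimes>\<^bsub>G\<^esub> b) \<otimes>\<^bsub>G\<^esub> y = (x \<otimes>\<^bsub>G\<^esub> inv\<^bsub>G\<^esub> y) \<otimes>\<^bsub>G\<^esub> b" if "x \<in> ?A" "y \<in> ?A" for x y
    using that swap[OF that(2)] AG by (simp add: m_assoc)
  note closed = subgroup.m_closed[OF A] subgroup.m_inv_closed[OF A] subgroup.one_closed[OF A]
  \<comment> \<open>The union contains the generators and their inverses, and \<open>mult\<close>
    and \<open>mult'\<close> make it closed under products.\<close>
  have "x \<in> ?A \<union> ?B" if "x \<in> generate G {a, b}" for x
    using that
  proof induction
    case one
    then show ?case using closed(3) by simp
  next
    case (incl h)
    then show ?case using closed(3) by (auto intro: generate.incl bexI[of _ "\<one>\<^bsub>G\<^esub>"] simp: r_coset_def)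
  next
    case (inv h)
    moreover have "inv\<^bsub>G\<^esub> b = b" using bb by (simp add: inv_equality)
    ultimately show ?case
      using closed(3) by (auto intro: generate.inv bexI[of _ "\<one>\<^bsub>G\<^esub>"] simp: r_coset_def)
  next
    case (eng h1 h2)
    have "x \<otimes>\<^bsub>G\<^esub> (y \<otimes>\<^bsub>G\<^esub> b) = (x \<otimes>\<^bsub>G\<^esub> y) \<otimes>\<^bsub>G\<^esub> b" if "x \<in> ?A" "y \<in> ?A" for x y
      using that AG by (simp add: m_assoc)
    then show ?case
      using eng.IH closed(1,2) mult mult' by (auto simp: r_coset_def)
  qed
  then have cover: "carrier G \<subseteq> ?A \<union> ?B" using gen by blast
  have finA: "finite ?A" using fin AG by (meson finite_subset subsetI)
  \<comment> \<open>This bounds \<open>card ?A\<close> by \<open>n\<close>. Conversely,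
    \<open>?A\<close> and its translate \<open>?B\<close> cover all \<open>2 * n\<close> elements,
    so \<open>card ?A\<close> is at least \<open>n\<close>.\<close>
  have "ord a dvd n" using an pow_eq_id by simp
  then have "card ?A \<le> n" using generate_pow_card[OF car(1)] assms(2) by (simp add: dvd_imp_le)
  moreover have "2 * n \<le> card ?A + card ?B"
    using card_mono[OF _ cover] card_Un_le[of ?A ?B] finA ord
    by (simp add: order_def r_coset_def)
  moreover have "card ?B \<le> card ?A"
    using card_image_le[OF finA, of "\<lambda>x. x \<otimes>\<^bsub>G\<^esub> b"] by (simp add: r_coset_def UNION_singleton_eq_range)
  ultimately show "card ?A = n" by linarith
  have reflection: "\<exists>y \<in> ?A. x = y \<otimes>\<^bsub>G\<^esub> b" if "x \<in> carrier G - ?A" for x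
    using that cover by (auto simp: r_coset_def)
  show "generalized_dihedral G ?A"
  proof (intro generalized_dihedral.intro generalized_dihedral_axioms.intro)
    show "group G" by (rule is_group)
    show "finite (carrier G)" by (rule fin)
    show "subgroup ?A G" by (rule A)
    show "x \<otimes>\<^bsub>G\<^esub> y = y \<otimes>\<^bsub>G\<^esub> x" if "x \<in> ?A" "y \<in> ?A" for x y
      using pow[OF that(1)] pow[OF that(2)] by (auto simp: nat_pow_mult add.commute)
    show "x \<otimes>\<^bsub>G\<^esub> x = \<one>\<^bsub>G\<^esub>" if "x \<in> carrier G - ?A" for x
      using reflection[OF that] mult AG by auto
    show "x \<otimes>\<^bsub>G\<^esub> y \<in> ?A" if "x \<in> carrier G - ?A" "y \<in> carrier G - ?A" for x y
      using reflection[OF that(1)] reflection[OF that(2)] mult closed(1,2) by auto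
  qed
qed

theorem theorem5p1:
  fixes G :: "('a, 'm) monoid_scheme" and a b :: 'a and n k :: nat and H :: "'a set"
  assumes "2 * n \<ge> 6"
    and "dihedral_group G n a b"
    and "subgroup H G" and "H \<noteq> carrier G"
    and "1 \<le> k" and "k \<le> card H"
  shows "(even k \<longrightarrow> group_zero_regular_set G k H) \<and>
         (odd k \<longrightarrow>
           (group_zero_regular_set G k H \<longleftrightarrow>
              \<not> H \<subseteq> generate G {a} \<or>
              (H \<subseteq> generate G {a} \<and> (odd (card H) \<or> odd (n div card H)))))"
proof -
  have n: "n > 0" using assms(1) by simp
  interpret generalized_dihedral G "generate G {a}"
    using dihedral_group_rotations(1)[OF assms(2) n] .
  have a: "a \<in> carrier G" using assms(2) by (simp add: dihedral_group_def)
  have card: "card (generate G {a}) = n"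
    using dihedral_group_rotations(2)[OF assms(2) n] .
  show ?thesis
  proof (cases "H \<subseteq> generate G {a}")
    \<comment> \<open>For odd \<open>k\<close>, the evenness lemma read contrapositively shows that
      the parity condition is necessary.\<close>
    case True
    then show ?thesis
      using regular_set_rotations[OF assms(3) True assms(4,6)]
        even_if_regular_set_rotations[OF assms(3) True assms(4) a refl] card
      by auto
  next
    case False
    then show ?thesis using regular_set_not_rotations[OF assms(3) False assms(4,6)] by blast
  qed
qed

end
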